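(* Let $\mathcal{I}=[a,b]$ with $0\le a<b$, and let $\rho\ne-1$ and $\nu>1$ be real numbers. Let $F:\mathcal{I}\rightrightarrows\mathbb{R}$ be a set-valued map with nonempty compact convex values which is Borel measurable and integrably bounded on $\mathcal{I}$. Assume that $F$ is of bounded variation on $\mathcal{I}$ with respect to the Hausdorff metric $H_d$. Then for each $t\in\mathcal{I}$ the Katugampola integral ${}_a^{\rho}\mathfrak{D}^{\nu}F(t)$ is nonempty, compact and convex, and the mapping $t\mapsto{}_a^{\rho}\mathfrak{D}^{\nu}F(t)$ is of bounded variation on $\mathcal{I}$ with respect to $H_d$.
   Context: A set-valued map $F:\mathcal{I}\rightrightarrows\mathbb{R}$ assigns to each $t\in\mathcal{I}$ a subset $F(t)\subset\mathbb{R}$; Borel measurability of set-valued maps is in the usual sense. An (integrable) selection of $F$ is a single-valued measurable function $f:\mathcal{I}\to\mathbb{R}$ with $f(t)\in F(t)$ for a.e. $t$ and $f\in L^1(\mathcal{I})$; $\mathfrak{I}$ denotes the collection of all integrable selections of $F$. $F$ is integrably bounded if there is an integrable function $m:\mathcal{I}\to\mathbb{R}$ such that $|s|\le m(t)$ for all $t\in\mathcal{I}$ and all $s\in F(t)$. The set-valued Katugampola fractional integral of $F$ (for real $\nu>0$, $\rho\ne-1$) is $${}_a^{\rho}\mathfrak{D}^{\nu}F(t)=\left\{\frac{(\rho+1)^{1-\nu}}{\Gamma(\nu)}\int_a^t (t^{\rho+1}-x^{\rho+1})^{\nu-1}x^{\rho}f(x)\,dx : f\in\mathfrak{I}\right\},\quad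 t\in\mathcal{I}.$$ For nonempty compact $A_1,A_2\subset\mathbb{R}$, $H_d(A_1,A_2)=\max\{\sup_{a_2\in A_2}\inf_{a_1\in A_1}|a_1-a_2|,\ \sup_{a_1\in A_1}\inf_{a_2\in A_2}|a_1-a_2|\}$. A map $G$ on $[a,b]$ with nonempty compact values in $\mathbb{R}$ is of bounded variation with respect to $H_d$ if $V_a^b(G)=\sup\sum_{i=1}^n H_d(G(t_i),G(t_{i-1}))<\infty$, the supremum being over all partitions $a=t_0<t_1<\dots<t_n=b$.
   Formalization: When a = 0 and ρ < -1 the defining integrals can diverge (e.g. F = {1}, ρ = -2, ν = 2), so in that case only it is additionally assumed that the integral exists for every integrable selection f and every t in I. *)

theory Defs
  imports "HOL-Analysis.Analysis"
begin

text \<open>A set-valued map on \<open>I \<subseteq> \<real>\<close> is a function \<open>real \<Rightarrow> real set\<close>; only its values on \<open>I\<close> matter.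
  Its measurability is stated through the (lower) inverse images of open sets.\<close>

definition borel_measurable_setmap :: "real set \<Rightarrow> (real \<Rightarrow> real set) \<Rightarrow> bool" where
  "borel_measurable_setmap I F \<longleftrightarrow>
     (\<forall>U. open U \<longrightarrow> {t \<in> I. F t \<inter> U \<noteq> {}} \<in> sets borel)"

definition integrable_selections :: "real set \<Rightarrow> (real \<Rightarrow> real set) \<Rightarrow> (real \<Rightarrow> real) set" where
  "integrable_selections I F =
     {f. integrable (lebesgue_on I) f \<and> (AE t in lebesgue_on I. f t \<in> F t)}"

definition integrably_bounded :: "real set \<Rightarrow> (real \<Rightarrow> real set) \<Rightarrow> bool" where
  "integrably_bounded I F \<longleftrightarrow>
     (\<exists>m. integrable (lebesgue_on I) m \<and> (\<forall>t\<in>I. \<forall>s\<in>F t. \<bar>s\<bar> \<le> m t))"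

definition katugampola_integrand ::
    "real \<Rightarrow> real \<Rightarrow> (real \<Rightarrow> real) \<Rightarrow> real \<Rightarrow> real \<Rightarrow> real" where
  "katugampola_integrand \<rho> \<nu> f t x =
     (t powr (\<rho> + 1) - x powr (\<rho> + 1)) powr (\<nu> - 1) * x powr \<rho> * f x"

text \<open>For \<open>\<rho> < -1\<close> both \<open>\<rho> + 1\<close> and \<open>t powr (\<rho> + 1) - x powr (\<rho> + 1)\<close> (for \<open>0 < x < t\<close>) are
  negative. Since \<open>c powr r = \<bar>c\<bar> powr r\<close> in HOL, the product of their powers is
  \<open>((t powr (\<rho> + 1) - x powr (\<rho> + 1)) / (\<rho> + 1)) powr (\<nu> - 1)\<close>, a power with positive base,
  just as it is for \<open>\<rho> > -1\<close>; the principal complex branches give the same value.\<close>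

definition katugampola_integral ::
    "real \<Rightarrow> real \<Rightarrow> real \<Rightarrow> (real \<Rightarrow> real) \<Rightarrow> real \<Rightarrow> real" where
  "katugampola_integral a \<rho> \<nu> f t =
     (\<rho> + 1) powr (1 - \<nu>) / Gamma \<nu> *
       (LINT x|lebesgue_on {a..t}. katugampola_integrand \<rho> \<nu> f t x)"

text \<open>The selections are selections on the whole interval \<open>{a..b}\<close>, for every \<open>t\<close>.\<close>

definition katugampola_set_integral ::
    "real \<Rightarrow> real \<Rightarrow> real \<Rightarrow> real \<Rightarrow> (real \<Rightarrow> real set) \<Rightarrow> real \<Rightarrow> real set" where
  "katugampola_set_integral a b \<rho> \<nu> F t =
     {katugampola_integral a \<rho> \<nu> f t | f. f \<in> integrable_selections {a..b} F}"

text \<open>Meaningful for nonempty bounded sets (in particular nonempty compact ones), where the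
  real-valued \<open>Sup\<close> and \<open>Inf\<close> are the true supremum and infimum.\<close>

definition hausdorff_distance :: "real set \<Rightarrow> real set \<Rightarrow> real" where
  "hausdorff_distance A1 A2 =
     max (SUP a2\<in>A2. INF a1\<in>A1. \<bar>a1 - a2\<bar>) (SUP a1\<in>A1. INF a2\<in>A2. \<bar>a1 - a2\<bar>)"

text \<open>A partition of \<open>{a..b}\<close> is a pair \<open>(n, t)\<close>; only \<open>t 0, ..., t n\<close> are relevant.\<close>

definition interval_partitions :: "real \<Rightarrow> real \<Rightarrow> (nat \<times> (nat \<Rightarrow> real)) set" where
  "interval_partitions a b =
     {(n, t). t 0 = a \<and> t n = b \<and> (\<forall>i<n. t i < t (Suc i))}"

definition hausdorff_variation :: "real \<Rightarrow> real \<Rightarrow> (real \<Rightarrow> real set) \<Rightarrow> ereal" where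
  "hausdorff_variation a b G =
     (SUP (n, t)\<in>interval_partitions a b.
        ereal (\<Sum>i=1..n. hausdorff_distance (G (t i)) (G (t (i - 1)))))"

definition bounded_variation_hausdorff :: "real \<Rightarrow> real \<Rightarrow> (real \<Rightarrow> real set) \<Rightarrow> bool" where
  "bounded_variation_hausdorff a b G \<longleftrightarrow> hausdorff_variation a b G < \<infinity>"

end

theory Submission
  imports Defs
begin

text \<open>Since \<open>F t\<close> is a compact interval \<open>{l t..u t}\<close> with measurable endpoints, and \<open>l\<close>, \<open>u\<close> are
  selections, the set-valued integral at \<open>t\<close> is the interval between the integrals of \<open>l\<close> and
  \<open>u\<close>: intermediate values are attained at convex combinations of \<open>l\<close> and \<open>u\<close>. The kernel
  \<open>\<bar>t powr (\<rho> + 1) - x powr (\<rho> + 1)\<bar> powr (\<nu> - 1) * x powr \<rho>\<close> is nonnegative and increasing in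
  \<open>t\<close>, whatever the sign of \<open>\<rho> + 1\<close>, so the increments of the integral of \<open>f\<close> are dominated by
  those of the integral of \<open>\<bar>f\<bar>\<close>. The variation is therefore bounded by a telescoping sum. The bounded
  variation of \<open>F\<close> enters by making \<open>F\<close> bounded, whence the integrals exist unless \<open>a = 0\<close> and
  \<open>\<rho> < -1\<close>.\<close>

section \<open>Hausdorff distance of compact intervals\<close>

text \<open>The distance from \<open>x\<close> to \<open>{r..s}\<close> is a convex function of
  \<open>x\<close>, so its supremum over \<open>{p..q}\<close> is attained at an endpoint.\<close>

lemma cSUP_cINF_dist_Icc:
  fixes p q r s :: real
  assumes "p \<le> q" "r \<le> s"
  shows "(SUP x\<in>{p..q}. INF y\<in>{r..s}. \<bar>y - x\<bar>) = max 0 (max (r - p) (q - s))"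
proof -
  have "(INF y\<in>{r..s}. \<bar>y - x\<bar>) = max 0 (max (r - x) (x - s))" for x
  proof (rule cInf_eq_minimum)
    \<comment> \<open>The nearest point of \<open>{r..s}\<close> is \<open>x\<close> clamped to that
      interval.\<close>
    show "max 0 (max (r - x) (x - s)) \<in> (\<lambda>y. \<bar>y - x\<bar>) ` {r..s}"
      using assms by (intro image_eqI[where x = "max r (min x s)"]) auto
  qed auto
  moreover have "(SUP x\<in>{p..q}. max 0 (max (r - x) (x - s))) = max 0 (max (r - p) (q - s))"
  proof (rule cSup_eq_maximum)
    show "max 0 (max (r - p) (q - s)) \<in> (\<lambda>x. max 0 (max (r - x) (x - s))) ` {p..q}"
      using assms by (intro image_eqI[where x = "if r - p \<ge> q - s then p else q"]) auto
  qed auto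
  ultimately show ?thesis by simp
qed

text \<open>The two one-sided terms together contain exactly the positive and negative parts of
  \<open>p - r\<close> and \<open>q - s\<close>.\<close>

lemma hausdorff_distance_Icc:
  assumes "p \<le> q" "r \<le> s"
  shows "hausdorff_distance {p..q} {r..s} = max \<bar>p - r\<bar> \<bar>q - s\<bar>"
proof -
  have "hausdorff_distance {p..q} {r..s} =
      max (max 0 (max (p - r) (s - q))) (max 0 (max (r - p) (q - s)))"
    using cSUP_cINF_dist_Icc[OF assms] cSUP_cINF_dist_Icc[OF assms(2,1)]
    unfolding hausdorff_distance_def by (simp add: abs_minus_commute)
  then show ?thesis by linarith
qed

section \<open>Partitions and bounded variation\<close>

lemma interval_partitions_mem:
  assumes "(n, t) \<in> interval_partitions a b" "i \<le> n"
  shows "t i \<in> {a..b}"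
proof -
  have *: "t 0 = a" "t n = b" "\<And>i. i < n \<Longrightarrow> t i < t (Suc i)"
    using assms(1) by (auto simp: interval_partitions_def)
  have "t j \<le> t k" if "j \<le> k" "k \<le> n" for j k
    using that
  proof (induction k rule: dec_induct)
    case (step k)
    then show ?case using *(3)[of k] by simp
  qed simp
  from this[of 0 i] this[of i n] show ?thesis
    using * assms(2) by auto
qed

text \<open>Each partition sum is dominated by increments of \<open>M\<close>, which add up to
  \<open>M b - M a\<close> for every partition.\<close>

lemma bounded_variation_hausdorff_telescope:
  fixes M :: "real \<Rightarrow> real"
  assumes "\<And>s t. a \<le> s \<Longrightarrow> s \<le> t \<Longrightarrow> t \<le> b \<Longrightarrow> hausdorff_distance (G t) (G s) \<le> M t - M s"
  shows "bounded_variation_hausdorff a b G"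
proof -
  have "(\<Sum>i=1..n. hausdorff_distance (G (t i)) (G (t (i - 1)))) \<le> M b - M a"
    if P: "(n, t) \<in> interval_partitions a b" for n t
  proof -
    have "(\<Sum>i=1..n. hausdorff_distance (G (t i)) (G (t (i - 1)))) \<le> (\<Sum>i=1..n. M (t i) - M (t (i - 1)))"
    proof (rule sum_mono)
      fix i assume i: "i \<in> {1..n}"
      then have "i - 1 < n" "Suc (i - 1) = i"
        by auto
      then have "t (i - 1) < t i"
        using P unfolding interval_partitions_def by fastforce
      then show "hausdorff_distance (G (t i)) (G (t (i - 1))) \<le> M (t i) - M (t (i - 1))"
        using i interval_partitions_mem[OF P, of i] interval_partitions_mem[OF P, of "i - 1"]
        by (intro assms) auto
    qed
    also have "\<dots> = M (t n) - M (t 0)"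
      using sum_telescope''[of 0 n "\<lambda>i. M (t i)"] by simp
    finally show ?thesis using P by (auto simp: interval_partitions_def)
  qed
  then have "hausdorff_variation a b G \<le> ereal (M b - M a)"
    unfolding hausdorff_variation_def by (intro SUP_least) auto
  then show ?thesis
    unfolding bounded_variation_hausdorff_def by (rule le_less_trans) simp
qed

text \<open>The distance from \<open>F t\<close> to \<open>F a\<close> is a term of a partition sum
  with at most two terms, so \<open>l t\<close> and \<open>u t\<close> stay within a fixed distance
  of \<open>l a\<close> and \<open>u a\<close>.\<close>

lemma bounded_variation_hausdorff_imp_bounded:
  fixes l u :: "real \<Rightarrow> real"
  assumes BV: "bounded_variation_hausdorff a b F" and "a \<le> b"
    and F: "\<And>t. t \<in> {a..b} \<Longrightarrow> F t = {l t..u t} \<and> l t \<le> u t"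
  obtains B where "\<And>t s. t \<in> {a..b} \<Longrightarrow> s \<in> F t \<Longrightarrow> \<bar>s\<bar> \<le> B"
proof -
  let ?S = "\<lambda>n t. \<Sum>i=1..n. hausdorff_distance (F (t i)) (F (t (i - 1)))"
  obtain V where "hausdorff_variation a b F \<le> ereal V"
    using BV less_PInf_Ex_of_nat[of "hausdorff_variation a b F"]
    unfolding bounded_variation_hausdorff_def by (auto intro: less_imp_le)
  then have V: "?S n t \<le> V" if "(n, t) \<in> interval_partitions a b" for n t
    using that unfolding hausdorff_variation_def SUP_le_iff by fastforce
  have hd: "hausdorff_distance (F t) (F s) = max \<bar>l t - l s\<bar> \<bar>u t - u s\<bar>"
    if "t \<in> {a..b}" "s \<in> {a..b}" for s t
    using that F by (auto simp: hausdorff_distance_Icc)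
  have osc: "max \<bar>l t - l a\<bar> \<bar>u t - u a\<bar> \<le> max 0 V" if "t \<in> {a..b}" for t
  proof -
    \<comment> \<open>Partition points increase strictly, so \<open>a, t, b\<close> is a partition
      only for \<open>t\<close> in the open interval; \<open>t = b\<close> uses \<open>a, b\<close>,
      and for \<open>t = a\<close> the left side is 0.\<close>
    consider "t = a" | "a < t" "t = b" | "a < t" "t < b" using \<open>t \<in> {a..b}\<close> by force
    then show ?thesis
    proof cases
      case 2
      then have "(1, \<lambda>i. if i = 0 then a else b) \<in> interval_partitions a b"
        by (simp add: interval_partitions_def)
      from V[OF this] have "hausdorff_distance (F t) (F a) \<le> V"
        using 2 by simp
      then show ?thesis using 2 by (simp add: hd le_max_iff_disj)
    next
      case 3
      then have "(2, \<lambda>i. if i = 0 then a else if i = 1 then t else b) \<in> interval_partitions a b"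
        by (auto simp: interval_partitions_def less_2_cases_iff)
      from V[OF this] have "hausdorff_distance (F t) (F a) + hausdorff_distance (F b) (F t) \<le> V"
        by (simp add: numeral_2_eq_2)
      moreover have "0 \<le> hausdorff_distance (F b) (F t)"
        using 3 by (simp add: hd le_max_iff_disj)
      ultimately have "hausdorff_distance (F t) (F a) \<le> V" by linarith
      then show ?thesis using 3 by (simp add: hd le_max_iff_disj)
    qed auto
  qed
  show ?thesis
  proof
    fix t s assume "t \<in> {a..b}" "s \<in> F t"
    then show "\<bar>s\<bar> \<le> \<bar>l a\<bar> + \<bar>u a\<bar> + max 0 V"
      using osc[of t] F[of t] by auto
  qed
qed

section \<open>The kernel: sign, monotonicity and bounds\<close>

definition katugampola_kernel :: "real \<Rightarrow> real \<Rightarrow> real \<Rightarrow> real \<Rightarrow> real" where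
  "katugampola_kernel \<rho> \<nu> t x = (t powr (\<rho> + 1) - x powr (\<rho> + 1)) powr (\<nu> - 1) * x powr \<rho>"

lemma katugampola_integrand_eq:
  "katugampola_integrand \<rho> \<nu> f t x = katugampola_kernel \<rho> \<nu> t x * f x"
  by (simp add: katugampola_integrand_def katugampola_kernel_def)

lemma katugampola_kernel_nonneg: "0 \<le> katugampola_kernel \<rho> \<nu> t x"
  by (simp add: katugampola_kernel_def)

lemma katugampola_kernel_measurable: "katugampola_kernel \<rho> \<nu> t \<in> borel_measurable (lebesgue_on S)"
proof -
  have "katugampola_kernel \<rho> \<nu> t \<in> borel_measurable borel"
    unfolding katugampola_kernel_def by measurable
  then show ?thesis
    by (intro measurable_restrict_space1 measurable_completion) simp
qed

lemma powr_abs_base: "\<bar>x\<bar> powr a = x powr a" for x a :: real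
  by (simp add: abs_if uminus_powr_eq)

text \<open>Real \<open>powr\<close> sees only the absolute value of its base. This covers
  \<open>\<rho> + 1 < 0\<close>, where the base in the kernel is negative.\<close>

lemma powr_mono2_abs:
  fixes x y :: real
  assumes "\<bar>x\<bar> \<le> \<bar>y\<bar>" "0 \<le> a"
  shows "x powr a \<le> y powr a"
  using powr_mono2[OF assms(2) abs_ge_zero assms(1)] by (simp add: powr_abs_base)

text \<open>Whether \<open>y powr (\<rho> + 1)\<close> increases or decreases in \<open>y\<close>,
  its gap to the value at \<open>x\<close> widens as \<open>y\<close> moves from \<open>s\<close> to
  \<open>t\<close>.\<close>

lemma katugampola_kernel_mono:
  assumes "1 \<le> \<nu>" "0 \<le> x" "x \<le> s" "s \<le> t"
  shows "katugampola_kernel \<rho> \<nu> s x \<le> katugampola_kernel \<rho> \<nu> t x"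
\<comment> \<open>At \<open>x = 0\<close> both sides vanish because
  \<open>0 powr \<rho> = 0\<close>; the decreasing case below needs a positive base.\<close>
proof (cases "x = 0")
  case True
  then show ?thesis by (simp add: katugampola_kernel_def)
next
  case False
  have "\<bar>s powr (\<rho> + 1) - x powr (\<rho> + 1)\<bar> \<le> \<bar>t powr (\<rho> + 1) - x powr (\<rho> + 1)\<bar>"
  proof (cases "0 \<le> \<rho> + 1")
    case True
    then show ?thesis
      using powr_mono2[of "\<rho> + 1" x s] powr_mono2[of "\<rho> + 1" s t] assms by auto
  next
    case neg: False
    then show ?thesis
      using powr_mono2'[of "\<rho> + 1" x s] powr_mono2'[of "\<rho> + 1" s t] assms False by auto
  qed
  then show ?thesis
    unfolding katugampola_kernel_def using assms by (intro mult_right_mono powr_mono2_abs) auto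
qed

text \<open>A monotone power is bounded by its value at one endpoint; the sum of both endpoint
  values serves either direction. Two numbers between 0 and this sum differ by at most the
  sum.\<close>

lemma katugampola_kernel_le:
  assumes "1 \<le> \<nu>" "0 \<le> a" "a \<le> x" "x \<le> t" "t \<le> b" "a = 0 \<Longrightarrow> -1 \<le> \<rho>"
  shows "katugampola_kernel \<rho> \<nu> t x \<le> (a powr (\<rho> + 1) + b powr (\<rho> + 1)) powr (\<nu> - 1) * x powr \<rho>"
proof -
  have *: "y powr (\<rho> + 1) \<le> a powr (\<rho> + 1) + b powr (\<rho> + 1)" if "a \<le> y" "y \<le> b" for y
  proof (cases "0 \<le> \<rho> + 1")
    case True
    then show ?thesis using powr_mono2[of "\<rho> + 1" y b] assms that by (simp add: add_increasing)
  next
    case False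
    \<comment> \<open>For \<open>a = 0\<close> the last assumption contradicts
      \<open>\<rho> + 1 < 0\<close>.\<close>
    then show ?thesis
      using powr_mono2'[of "\<rho> + 1" a y] assms that by (cases "a = 0") (simp_all add: add_increasing2)
  qed
  have "\<bar>t powr (\<rho> + 1) - x powr (\<rho> + 1)\<bar> \<le> \<bar>a powr (\<rho> + 1) + b powr (\<rho> + 1)\<bar>"
    using *[of t] *[of x] assms powr_ge_zero[of t "\<rho> + 1"] powr_ge_zero[of x "\<rho> + 1"] by linarith
  then show ?thesis
    unfolding katugampola_kernel_def using assms by (intro mult_right_mono powr_mono2_abs) auto
qed

section \<open>Existence of the integrals\<close>

lemma integrable_lebesgue_on_Icc_subset:
  fixes f :: "real \<Rightarrow> real"
  assumes "integrable (lebesgue_on {a..b}) f" "a \<le> c" "d \<le> b"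
  shows "integrable (lebesgue_on {c..d}) f"
  using set_integrable_subset[of lebesgue "{a..b}" f "{c..d}"] assms
  by (simp add: set_integrable_def integrable_restrict_space)

lemma integrable_powr_lebesgue_on:
  fixes a b \<rho> :: real
  assumes "0 \<le> a" "a \<le> b" "a = 0 \<Longrightarrow> -1 < \<rho>"
  shows "integrable (lebesgue_on {a..b}) (\<lambda>x. x powr \<rho>)"
proof -
  have "(\<lambda>x. x powr \<rho>) integrable_on {a..b}"
  proof (cases "a = 0")
    case True
    then show ?thesis using assms integrable_on_powr_from_0[of \<rho> b] by simp
  next
    case False
    then show ?thesis
      using assms by (intro integrable_continuous_interval continuous_intros) auto
  qed
  \<comment> \<open>Nonnegativity upgrades gauge integrability to Lebesgue integrability.\<close>
  then have "(\<lambda>x. x powr \<rho>) absolutely_integrable_on {a..b}"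
    by (intro nonnegative_absolutely_integrable_1) auto
  then show ?thesis by (simp add: set_integrable_def integrable_restrict_space)
qed

lemma AE_lebesgue_on_subset:
  assumes "AE x in lebesgue_on T. P x" "S \<subseteq> T" "S \<in> sets lebesgue" "T \<in> sets lebesgue"
  shows "AE x in lebesgue_on S. P x"
  using assms by (auto simp: AE_restrict_space_iff elim!: eventually_mono)

text \<open>The integrand is dominated by a constant multiple of \<open>x powr \<rho>\<close>. An
  integrable but unbounded \<open>f\<close> could fail for \<open>a = 0\<close> and
  \<open>\<rho> < 0\<close>, as both \<open>f\<close> and \<open>x powr \<rho>\<close> may blow up
  at 0.\<close>

lemma integrable_katugampola_integrand:
  assumes "1 \<le> \<nu>" "0 \<le> a" "a = 0 \<Longrightarrow> -1 < \<rho>" "t \<in> {a..b}"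
    and f: "integrable (lebesgue_on {a..b}) f" and B: "AE x in lebesgue_on {a..b}. \<bar>f x\<bar> \<le> B"
  shows "integrable (lebesgue_on {a..t}) (katugampola_integrand \<rho> \<nu> f t)"
proof -
  define C where "C = (a powr (\<rho> + 1) + b powr (\<rho> + 1)) powr (\<nu> - 1)"
  have ab: "a \<le> t" "t \<le> b" using assms(4) by auto
  have "integrable (lebesgue_on {a..t}) (\<lambda>x. C * x powr \<rho> * B)"
    using assms ab by (intro integrable_mult_left integrable_mult_right integrable_powr_lebesgue_on) auto
  moreover have "katugampola_integrand \<rho> \<nu> f t \<in> borel_measurable (lebesgue_on {a..t})"
    unfolding katugampola_integrand_eq[abs_def]
    using integrable_lebesgue_on_Icc_subset[OF f, of a t] ab
    by (intro borel_measurable_times katugampola_kernel_measurable borel_measurable_integrable) auto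
  moreover have "AE x in lebesgue_on {a..t}. norm (katugampola_integrand \<rho> \<nu> f t x) \<le> norm (C * x powr \<rho> * B)"
  proof -
    have "AE x in lebesgue_on {a..t}. \<bar>f x\<bar> \<le> B"
      using ab by (intro AE_lebesgue_on_subset[OF B]) auto
    moreover have "AE x in lebesgue_on {a..t}. x \<in> {a..t}"
      by (rule AE_I2) simp
    ultimately show ?thesis
    proof eventually_elim
      case (elim x)
      have "katugampola_kernel \<rho> \<nu> t x * \<bar>f x\<bar> \<le> (C * x powr \<rho>) * B"
        using katugampola_kernel_le[of \<nu> a x t b \<rho>] elim assms(1-3) ab unfolding C_def
        by (intro mult_mono) (auto simp: less_imp_le)
      then have "norm (katugampola_integrand \<rho> \<nu> f t x) \<le> C * x powr \<rho> * B"
        by (simp add: katugampola_integrand_eq abs_mult katugampola_kernel_nonneg)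
      then show ?case by simp
    qed
  qed
  ultimately show ?thesis by (rule Bochner_Integration.integrable_bound)
qed

section \<open>Monotonicity, linearity and increments of the integral\<close>

lemma katugampola_constant_nonneg: "0 < \<nu> \<Longrightarrow> 0 \<le> (\<rho> + 1) powr (1 - \<nu>) / Gamma \<nu>" for \<rho> \<nu> :: real
  by simp

lemma katugampola_integral_mono:
  assumes "0 < \<nu>"
    and "integrable (lebesgue_on {a..t}) (katugampola_integrand \<rho> \<nu> f t)"
    and "integrable (lebesgue_on {a..t}) (katugampola_integrand \<rho> \<nu> g t)"
    and "AE x in lebesgue_on {a..t}. f x \<le> g x"
  shows "katugampola_integral a \<rho> \<nu> f t \<le> katugampola_integral a \<rho> \<nu> g t"
proof -
  have "AE x in lebesgue_on {a..t}. katugampola_integrand \<rho> \<nu> f t x \<le> katugampola_integrand \<rho> \<nu> g t x"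
    using assms(4) by eventually_elim
      (simp add: katugampola_integrand_eq mult_left_mono katugampola_kernel_nonneg)
  then show ?thesis
    unfolding katugampola_integral_def
    by (intro mult_left_mono integral_mono_AE assms katugampola_constant_nonneg)
qed

lemma katugampola_integral_linear:
  assumes "integrable (lebesgue_on {a..t}) (katugampola_integrand \<rho> \<nu> f t)"
    and "integrable (lebesgue_on {a..t}) (katugampola_integrand \<rho> \<nu> g t)"
  shows "katugampola_integral a \<rho> \<nu> (\<lambda>x. c * f x + d * g x) t =
    c * katugampola_integral a \<rho> \<nu> f t + d * katugampola_integral a \<rho> \<nu> g t"
proof -
  have "katugampola_integrand \<rho> \<nu> (\<lambda>x. c * f x + d * g x) t =
      (\<lambda>x. c * katugampola_integrand \<rho> \<nu> f t x + d * katugampola_integrand \<rho> \<nu> g t x)"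
    by (auto simp: katugampola_integrand_eq algebra_simps)
  then show ?thesis
    using assms by (simp add: katugampola_integral_def algebra_simps)
qed

text \<open>After extension by zero both integrals run over the whole line, and the extended kernel
  increases with the upper limit. The estimate then holds pointwise and is integrated.\<close>

lemma katugampola_integral_increment_le:
  assumes "1 \<le> \<nu>" "0 \<le> a" "s \<le> t"
    and fs: "integrable (lebesgue_on {a..s}) (katugampola_integrand \<rho> \<nu> f s)"
    and ft: "integrable (lebesgue_on {a..t}) (katugampola_integrand \<rho> \<nu> f t)"
  shows "\<bar>katugampola_integral a \<rho> \<nu> f t - katugampola_integral a \<rho> \<nu> f s\<bar> \<le>
    katugampola_integral a \<rho> \<nu> (\<lambda>x. \<bar>f x\<bar>) t - katugampola_integral a \<rho> \<nu> (\<lambda>x. \<bar>f x\<bar>) s"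
proof -
  define h where "h g r x = indicator {a..r} x * katugampola_integrand \<rho> \<nu> g r x" for g r x
  have J: "katugampola_integral a \<rho> \<nu> g r = (\<rho> + 1) powr (1 - \<nu>) / Gamma \<nu> * (LINT x|lebesgue. h g r x)"
    for g r by (simp add: katugampola_integral_def h_def integral_restrict_space)
  have h_abs: "h (\<lambda>x. \<bar>f x\<bar>) r x = \<bar>h f r x\<bar>" for r x
    by (simp add: h_def katugampola_integrand_eq abs_mult katugampola_kernel_nonneg)
  have int: "integrable lebesgue (h f s)" "integrable lebesgue (h f t)"
    using fs ft by (simp_all add: h_def[abs_def] integrable_restrict_space)
  \<comment> \<open>On \<open>{a..s}\<close> both sides equal the kernel increment times
    \<open>\<bar>f x\<bar>\<close>; elsewhere \<open>h f s\<close> vanishes.\<close>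
  have le: "\<bar>h f t x - h f s x\<bar> \<le> \<bar>h f t x\<bar> - \<bar>h f s x\<bar>" for x
  proof (cases "x \<in> {a..s}")
    case True
    then have k: "katugampola_kernel \<rho> \<nu> s x \<le> katugampola_kernel \<rho> \<nu> t x"
      using assms(1-3) by (intro katugampola_kernel_mono) auto
    have "\<bar>h f t x - h f s x\<bar> = (katugampola_kernel \<rho> \<nu> t x - katugampola_kernel \<rho> \<nu> s x) * \<bar>f x\<bar>"
      using True assms(3) k
      by (simp add: h_def katugampola_integrand_eq left_diff_distrib[symmetric] abs_mult)
    then show ?thesis
      using True assms(3)
      by (simp add: h_def katugampola_integrand_eq abs_mult katugampola_kernel_nonneg left_diff_distrib)
  qed (simp add: h_def)
  have "\<bar>LINT x|lebesgue. h f t x - h f s x\<bar> \<le> (LINT x|lebesgue. \<bar>h f t x\<bar> - \<bar>h f s x\<bar>)"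
    using int le by (intro integral_abs_bound_integral) auto
  then have "\<bar>(LINT x|lebesgue. h f t x) - (LINT x|lebesgue. h f s x)\<bar> \<le>
      (LINT x|lebesgue. \<bar>h f t x\<bar>) - (LINT x|lebesgue. \<bar>h f s x\<bar>)"
    using int by simp
  from mult_left_mono[OF this katugampola_constant_nonneg[of \<nu> \<rho>]] show ?thesis
    unfolding J h_abs right_diff_distrib[symmetric] abs_mult using assms(1) by simp
qed

section \<open>Interval-valued maps and their set-valued integral\<close>

text \<open>Open rays as test sets suffice: \<open>F t\<close> meets \<open>{..<c}\<close> iff
  \<open>l t < c\<close>, and meets \<open>{c<..}\<close> iff \<open>c < u t\<close>.\<close>

lemma borel_measurable_setmap_endpoints:
  assumes F: "borel_measurable_setmap I F" and I: "I \<in> sets lebesgue"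
    and "\<And>t. t \<in> I \<Longrightarrow> F t = {l t..u t} \<and> l t \<le> u t"
  shows "l \<in> borel_measurable (lebesgue_on I)" "u \<in> borel_measurable (lebesgue_on I)"
proof -
  have *: "{t \<in> I. F t \<inter> U \<noteq> {}} \<in> sets (lebesgue_on I)" if "open U" for U
    using F that I unfolding borel_measurable_setmap_def by (auto simp: sets_restrict_space_iff)
  have "F t \<inter> {..<c} \<noteq> {} \<longleftrightarrow> l t < c" "F t \<inter> {c<..} \<noteq> {} \<longleftrightarrow> c < u t" if "t \<in> I" for t c
    using assms(3)[OF that] unfolding disjoint_iff
    by (auto simp: not_less intro: order_trans)
  then have "{t \<in> I. F t \<inter> {..<c} \<noteq> {}} = {t \<in> space (lebesgue_on I). l t < c}"
    "{t \<in> I. F t \<inter> {c<..} \<noteq> {}} = {t \<in> space (lebesgue_on I). c < u t}" for c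
    by (simp_all cong: conj_cong)
  with *[OF open_lessThan] *[OF open_greaterThan]
  show "l \<in> borel_measurable (lebesgue_on I)" "u \<in> borel_measurable (lebesgue_on I)"
    by (simp_all only: borel_measurable_iff_less[of l] borel_measurable_iff_greater[of u] simp_thms)
qed

text \<open>Monotonicity gives one inclusion, linearity the other. Integrability is demanded for
  every selection because a non-integrable integrand has integral 0 by convention, which could break
  both properties.\<close>

lemma katugampola_set_integral_Icc:
  assumes "0 < \<nu>" "t \<in> {a..b}"
    and F: "\<And>x. x \<in> {a..b} \<Longrightarrow> F x = {l x..u x}"
    and l: "l \<in> integrable_selections {a..b} F" and u: "u \<in> integrable_selections {a..b} F"
    and int: "\<And>f. f \<in> integrable_selections {a..b} F \<Longrightarrow>
      integrable (lebesgue_on {a..t}) (katugampola_integrand \<rho> \<nu> f t)"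
  shows "katugampola_set_integral a b \<rho> \<nu> F t =
    {katugampola_integral a \<rho> \<nu> l t..katugampola_integral a \<rho> \<nu> u t}"
proof (intro equalityI subsetI)
  fix y assume "y \<in> katugampola_set_integral a b \<rho> \<nu> F t"
  then obtain f where f: "f \<in> integrable_selections {a..b} F" and y: "y = katugampola_integral a \<rho> \<nu> f t"
    unfolding katugampola_set_integral_def by blast
  have "AE x in lebesgue_on {a..b}. f x \<in> F x" using f by (simp add: integrable_selections_def)
  then have "AE x in lebesgue_on {a..b}. l x \<le> f x \<and> f x \<le> u x"
    by (rule lebesgue_on_mono) (simp add: F)
  then have "AE x in lebesgue_on {a..t}. l x \<le> f x \<and> f x \<le> u x"
    by (rule AE_lebesgue_on_subset) (use \<open>t \<in> {a..b}\<close> in auto)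
  then have "AE x in lebesgue_on {a..t}. l x \<le> f x" "AE x in lebesgue_on {a..t}. f x \<le> u x"
    by simp_all
  then show "y \<in> {katugampola_integral a \<rho> \<nu> l t..katugampola_integral a \<rho> \<nu> u t}"
    using katugampola_integral_mono[OF assms(1) int[OF l] int[OF f]]
      katugampola_integral_mono[OF assms(1) int[OF f] int[OF u]] by (simp add: y)
next
  fix y assume "y \<in> {katugampola_integral a \<rho> \<nu> l t..katugampola_integral a \<rho> \<nu> u t}"
  \<comment> \<open>Reading the interval as a segment yields a weight \<open>c\<close> independent
    of \<open>x\<close>, which then defines the selection.\<close>
  then have "y \<in> closed_segment (katugampola_integral a \<rho> \<nu> l t) (katugampola_integral a \<rho> \<nu> u t)"
    by (simp add: closed_segment_eq_real_ivl)
  then obtain c where c: "0 \<le> c" "c \<le> 1"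
    and y: "y = (1 - c) * katugampola_integral a \<rho> \<nu> l t + c * katugampola_integral a \<rho> \<nu> u t"
    by (auto simp: closed_segment_def)
  have "AE x in lebesgue_on {a..b}. l x \<in> F x \<and> u x \<in> F x"
    using l u by (simp add: integrable_selections_def)
  then have "AE x in lebesgue_on {a..b}. (1 - c) * l x + c * u x \<in> F x"
  proof (rule lebesgue_on_mono)
    fix x assume x: "l x \<in> F x \<and> u x \<in> F x" "x \<in> {a..b}"
    then have "(1 - c) *\<^sub>R l x + c *\<^sub>R u x \<in> F x"
      using F c by (intro convexD_alt) auto
    then show "(1 - c) * l x + c * u x \<in> F x" by simp
  qed
  then have "(\<lambda>x. (1 - c) * l x + c * u x) \<in> integrable_selections {a..b} F"
    using l u by (simp add: integrable_selections_def)
  then show "y \<in> katugampola_set_integral a b \<rho> \<nu> F t"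
    unfolding katugampola_set_integral_def y
    using katugampola_integral_linear[OF int[OF l] int[OF u]] by (auto intro!: exI)
qed

theorem theorem4p1:
  fixes a b \<rho> \<nu> :: real and F :: "real \<Rightarrow> real set"
  assumes "0 \<le> a" and "a < b"
    and "\<rho> \<noteq> -1" and "\<nu> > 1"
    and "\<And>t. t \<in> {a..b} \<Longrightarrow> F t \<noteq> {} \<and> compact (F t) \<and> convex (F t)"
    and "borel_measurable_setmap {a..b} F"
    and "integrably_bounded {a..b} F"
    and "bounded_variation_hausdorff a b F"
    \<comment> \<open>If \<open>a = 0\<close> and \<open>\<rho> < -1\<close> the kernel is not integrable at \<open>0\<close>, so there (and only there)
        the existence of the defining integrals has to be assumed.\<close>
    and "\<And>f t. a = 0 \<Longrightarrow> \<rho> < -1 \<Longrightarrow> f \<in> integrable_selections {a..b} F \<Longrightarrow> t \<in> {a..b} \<Longrightarrow>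
           integrable (lebesgue_on {a..t}) (katugampola_integrand \<rho> \<nu> f t)"
  shows "(\<forall>t\<in>{a..b}. katugampola_set_integral a b \<rho> \<nu> F t \<noteq> {} \<and>
                      compact (katugampola_set_integral a b \<rho> \<nu> F t) \<and>
                      convex (katugampola_set_integral a b \<rho> \<nu> F t)) \<and>
         bounded_variation_hausdorff a b (katugampola_set_integral a b \<rho> \<nu> F)"
proof -
  have "\<forall>t\<in>{a..b}. \<exists>p q. F t = {p..q} \<and> p \<le> q"
  proof
    fix t assume "t \<in> {a..b}"
    with assms(5) have "F t \<noteq> {}" "compact (F t)" "connected (F t)"
      by (auto intro: convex_connected)
    then show "\<exists>p q. F t = {p..q} \<and> p \<le> q"
      using connected_compact_interval_1[of "F t"] by fastforce
  qed
  then obtain l u where F: "\<And>t. t \<in> {a..b} \<Longrightarrow> F t = {l t..u t} \<and> l t \<le> u t"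
    by metis
  obtain m where m: "integrable (lebesgue_on {a..b}) m" "\<And>t s. t \<in> {a..b} \<Longrightarrow> s \<in> F t \<Longrightarrow> \<bar>s\<bar> \<le> m t"
    using assms(7) unfolding integrably_bounded_def by blast
  \<comment> \<open>Integrable boundedness makes every measurable pointwise selection integrable, in
    particular \<open>l\<close> and \<open>u\<close>.\<close>
  have sel: "f \<in> integrable_selections {a..b} F"
    if "f \<in> borel_measurable (lebesgue_on {a..b})" "\<And>t. t \<in> {a..b} \<Longrightarrow> f t \<in> F t" for f
  proof -
    have "integrable (lebesgue_on {a..b}) f"
      using that m by (intro Bochner_Integration.integrable_bound[OF m(1)] AE_I2) fastforce+
    moreover have "AE t in lebesgue_on {a..b}. f t \<in> F t"
      using that(2) by (intro AE_I2) simp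
    ultimately show ?thesis by (simp add: integrable_selections_def)
  qed
  have l: "l \<in> integrable_selections {a..b} F" and u: "u \<in> integrable_selections {a..b} F"
    using F borel_measurable_setmap_endpoints[OF assms(6) _ F] by (auto intro!: sel)
  \<comment> \<open>The bound \<open>m\<close> is only integrable; bounded variation supplies the
    constant bound that dominating the integrand calls for.\<close>
  obtain B where B: "\<And>t s. t \<in> {a..b} \<Longrightarrow> s \<in> F t \<Longrightarrow> \<bar>s\<bar> \<le> B"
    using bounded_variation_hausdorff_imp_bounded[OF assms(8) less_imp_le[OF assms(2)] F] by metis
  have int: "integrable (lebesgue_on {a..t}) (katugampola_integrand \<rho> \<nu> f t)"
    if f: "f \<in> integrable_selections {a..b} F" and t: "t \<in> {a..b}" for f t
  proof (cases "a = 0 \<and> \<rho> < -1")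
    case True
    then show ?thesis using assms(9) f t by blast
  next
    \<comment> \<open>If \<open>a = 0\<close>, then \<open>\<rho> \<noteq> -1\<close> leaves
      \<open>\<rho> > -1\<close>, so \<open>x powr \<rho>\<close> is integrable at 0.\<close>
    case False
    have "AE x in lebesgue_on {a..b}. f x \<in> F x" using f by (simp add: integrable_selections_def)
    then have "AE x in lebesgue_on {a..b}. \<bar>f x\<bar> \<le> B"
      by (rule lebesgue_on_mono) (use B in auto)
    with False show ?thesis
      using f t assms(1,3,4)
      by (intro integrable_katugampola_integrand[where b = b and B = B])
        (auto simp: integrable_selections_def)
  qed
  define G where "G = katugampola_set_integral a b \<rho> \<nu> F"
  define J where "J = katugampola_integral a \<rho> \<nu>"
  have G: "G t = {J l t..J u t}" if "t \<in> {a..b}" for t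
    unfolding G_def J_def using that F l u int assms(4) by (intro katugampola_set_integral_Icc) auto
  have le: "J l t \<le> J u t" if "t \<in> {a..b}" for t
  proof -
    \<comment> \<open>An interval with a member is nonempty, which orders its endpoints.\<close>
    have "J l t \<in> G t" using l unfolding G_def J_def katugampola_set_integral_def by blast
    then show ?thesis using G[OF that] by simp
  qed
  have inc: "\<bar>J f t - J f s\<bar> \<le> J (\<lambda>x. \<bar>f x\<bar>) t - J (\<lambda>x. \<bar>f x\<bar>) s"
    if "f \<in> integrable_selections {a..b} F" "a \<le> s" "s \<le> t" "t \<le> b" for f s t
    unfolding J_def using that int assms(1,4) by (intro katugampola_integral_increment_le) auto
  have "bounded_variation_hausdorff a b G"
  proof (rule bounded_variation_hausdorff_telescope)
    fix s t assume st: "a \<le> s" "s \<le> t" "t \<le> b"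
    then have "hausdorff_distance (G t) (G s) = max \<bar>J l t - J l s\<bar> \<bar>J u t - J u s\<bar>"
      using G le by (simp add: hausdorff_distance_Icc)
    \<comment> \<open>The maximum of the two endpoint increments is at most the sum of their
      nonnegative bounds, so \<open>M\<close> is the sum of the integrals of
      \<open>\<bar>l\<bar>\<close> and \<open>\<bar>u\<bar>\<close>.\<close>
    then show "hausdorff_distance (G t) (G s) \<le>
        (J (\<lambda>x. \<bar>l x\<bar>) t + J (\<lambda>x. \<bar>u x\<bar>) t) - (J (\<lambda>x. \<bar>l x\<bar>) s + J (\<lambda>x. \<bar>u x\<bar>) s)"
      using inc[OF l st] inc[OF u st] by linarith
  qed
  then show ?thesis
    using G le by (simp add: G_def[symmetric])
qed

end
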